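(* For every $x\in[0,1]$ not in the boundary of the partition $(P_n)_{n\ge1}$, i.e. $x\ne1$ and $x\neq\frac{n-1}{n}$ for all $n\in\mathbb{N}$, we have $$R(x)=J^{\tau(x)}(x).$$
   Context: $\mathbb{N}=\{1,2,\dots\}$ and $[y]$ denotes the integer part (floor) of a real $y$. The Renyi map $R:[0,1)\to[0,1)$ is $R(x)=\frac{1}{1-x}-\left[\frac{1}{1-x}\right]$. The Backward Farey map $J:[0,1]\to[0,1]$ is $J(x)=\frac{x}{1-x}$ for $x\in[0,1/2)$ and $J(x)=\frac{2x-1}{x}$ for $x\in[1/2,1]$; $J^m$ denotes its $m$-th iterate. For $n\in\mathbb{N}$, $P_n=\left[\frac{n-1}{n},\frac{n}{n+1}\right)$. The function $\tau$ (one plus the first hitting time to $P_1=[0,1/2)$) is $$\tau(x)=1+\min\{n\in\mathbb{N}\cup\{0\}: J^n(x)\in P_1\}.$$ *)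

theory Defs
  imports Complex_Main
begin

text \<open>The maps are total functions on the reals; only their values on the stated domains
  (\<open>[0,1)\<close> for the Renyi map, \<open>[0,1]\<close> for the backward Farey map) carry meaning.\<close>

definition renyi :: "real \<Rightarrow> real" where
  "renyi x = 1 / (1 - x) - of_int \<lfloor>1 / (1 - x)\<rfloor>"

definition backward_farey :: "real \<Rightarrow> real" where
  "backward_farey x = (if x < 1/2 then x / (1 - x) else (2 * x - 1) / x)"

definition renyi_cell :: "nat \<Rightarrow> real set" where
  "renyi_cell n = {(real n - 1) / real n ..< real n / (real n + 1)}"

text \<open>As \<open>LEAST\<close> is unspecified when no witness exists, \<open>farey_tau x\<close> is meaningful only
  for those \<open>x\<close> whose orbit visits \<open>renyi_cell 1 = [0,1/2)\<close>. This is every point of \<open>[0,1)\<close>;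
  the point \<open>1\<close> is fixed by \<open>backward_farey\<close> and never visits that cell.\<close>

definition farey_tau :: "real \<Rightarrow> nat" where
  "farey_tau x = 1 + (LEAST n. (backward_farey ^^ n) x \<in> renyi_cell 1)"

end

theory Submission
  imports Defs
begin

text \<open>In the coordinate \<open>u = 1 / (1 - x) \<ge> 1\<close> the Renyi map takes the fractional part of \<open>u\<close>. The
  backward Farey map acts as \<open>u \<mapsto> u - 1\<close> while \<open>u \<ge> 2\<close>, and sends a point with \<open>u < 2\<close>, that is,
  a point of the first cell, to the point \<open>u - 1\<close> in the original coordinate.\<close>

lemma backward_farey_slow:
  assumes "u \<ge> 2"
  shows "backward_farey (1 - 1 / u) = 1 - 1 / (u - 1)"
  using assms by (auto simp: backward_farey_def field_simps)

lemma backward_farey_exit: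
  assumes "1 \<le> u" "u < 2"
  shows "backward_farey (1 - 1 / u) = u - 1"
  using assms by (auto simp: backward_farey_def field_simps)

text \<open>Before each of the \<open>n\<close> steps the coordinate is at least
  \<open>u - (real n - 1)\<close>, hence at least 2, so every step is a slow one.\<close>

lemma backward_farey_funpow_slow:
  assumes "real n + 1 \<le> u"
  shows "(backward_farey ^^ n) (1 - 1 / u) = 1 - 1 / (u - real n)"
  using assms
proof (induction n)
  case (Suc n)
  then have "backward_farey (1 - 1 / (u - real n)) = 1 - 1 / (u - real n - 1)"
    by (intro backward_farey_slow) simp
  moreover have "(backward_farey ^^ n) (1 - 1 / u) = 1 - 1 / (u - real n)"
    using Suc by simp
  ultimately show ?case by (simp add: diff_diff_eq add.commute)
qed simp

lemma mem_renyi_cell_1_iff: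
  assumes "u \<ge> 1"
  shows "1 - 1 / u \<in> renyi_cell 1 \<longleftrightarrow> u < 2"
  using assms by (auto simp: renyi_cell_def field_simps)

text \<open>Slow steps lower \<open>u\<close> by 1 each, so the coordinate first drops below 2 after
  \<open>\<lfloor>u\<rfloor> - 1\<close> of them; the \<open>1 +\<close> in \<open>farey_tau\<close>
  restores the floor.\<close>

lemma farey_tau_eq_floor:
  assumes "u \<ge> 1"
  shows "farey_tau (1 - 1 / u) = nat \<lfloor>u\<rfloor>"
proof -
  define m where "m = nat \<lfloor>u\<rfloor> - 1"
  have m: "nat \<lfloor>u\<rfloor> = 1 + m" "real m + 1 \<le> u" "u < real m + 2"
    using assms unfolding m_def by linarith+
  \<comment> \<open>The bound \<open>n \<le> m\<close> keeps the orbit within the range of the slow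
    formula; minimality only concerns times up to \<open>m\<close>.\<close>
  have hit: "(backward_farey ^^ n) (1 - 1 / u) \<in> renyi_cell 1 \<longleftrightarrow> u < real n + 2"
    if "n \<le> m" for n
  proof -
    have le: "real n + 1 \<le> u" using that m(2) by linarith
    then show ?thesis
      using mem_renyi_cell_1_iff[of "u - real n"]
      by (auto simp: backward_farey_funpow_slow[OF le])
  qed
  have "(LEAST n. (backward_farey ^^ n) (1 - 1 / u) \<in> renyi_cell 1) = m"
  proof (rule Least_equality)
    show "(backward_farey ^^ m) (1 - 1 / u) \<in> renyi_cell 1"
      using hit m(3) by simp
  next
    fix n assume n: "(backward_farey ^^ n) (1 - 1 / u) \<in> renyi_cell 1"
    show "m \<le> n"
    proof (rule ccontr)
      assume "\<not> m \<le> n"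
      \<comment> \<open>From \<open>n < m\<close> follows
        \<open>real n + 2 \<le> real m + 1 \<le> u\<close>, so time \<open>n\<close> is too early
        for a hit.\<close>
      then show False using hit[of n] n m(2) by simp
    qed
  qed
  then show ?thesis unfolding farey_tau_def m(1) by simp
qed

theorem lemma7p5:
  fixes x :: real
  assumes "x \<in> {0..1}"
    and "x \<noteq> 1"
    and "\<forall>n::nat. n \<ge> 1 \<longrightarrow> x \<noteq> (real n - 1) / real n"
  shows "renyi x = (backward_farey ^^ farey_tau x) x"
proof -
  define u where "u = 1 / (1 - x)"
  have u: "u \<ge> 1" and x: "x = 1 - 1 / u"
    using assms(1,2) by (auto simp: u_def field_simps)
  define m where "m = nat \<lfloor>u\<rfloor> - 1"
  have m: "nat \<lfloor>u\<rfloor> = Suc m" "of_int \<lfloor>u\<rfloor> = real m + 1" "real m + 1 \<le> u" "u < real m + 2"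
    using u unfolding m_def by linarith+
  \<comment> \<open>Of the \<open>Suc m\<close> iterations the first \<open>m\<close> are slow; the
    outermost one is the exit from the first cell.\<close>
  have "(backward_farey ^^ farey_tau x) x = backward_farey ((backward_farey ^^ m) (1 - 1 / u))"
    unfolding x farey_tau_eq_floor[OF u] m(1) by simp
  also have "\<dots> = backward_farey (1 - 1 / (u - real m))"
    using backward_farey_funpow_slow[OF m(3)] by simp
  \<comment> \<open>Now \<open>u - real m\<close> lies in \<open>[1, 2)\<close>, so the exit step
    yields the fractional part of \<open>u\<close>.\<close>
  also have "\<dots> = u - real m - 1"
    using m(3,4) by (intro backward_farey_exit) auto
  also have "\<dots> = renyi x"
    unfolding renyi_def u_def[symmetric] m(2) by simp
  finally show ?thesis ..
qed

end
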